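(* Let $\zeta=(p/q,r/s)$ be a rational critical point with two neighbours (i.e. $r/s\neq0,1$), let $p_k/q_k$ be the convergents of the continued fraction expansion of $p/q=p_n/q_n$ whose last coefficient is $1$, let $$\tau=q'\frac rs,\qquad \tau^\pm=q'\Bigl(\frac rs\pm\frac1q\Bigr),\qquad q'=(-1)^{n-1}q_{n-1},$$ $$\mu=2\lfloor\tau\rfloor-\lfloor\tau^-\rfloor-\lfloor\tau^+\rfloor,\qquad \psi_{+1}(x)=\lfloor x\rfloor,\quad \psi_{-1}(x)=\lceil x\rceil,$$ and for $\nu\in\{+1,-1\}$ let $$ \chi^{(1)}_\nu=\biggl(\frac{p_{n-1}}{q_{n-1}},\ \frac{\psi_\nu(\tau)}{q_{n-1}}(-1)^{n-1}\biggr), \qquad \chi^{(2)}_\nu=\biggl(\frac{p_{n-2}}{q_{n-2}},\ \frac{rq_n}{sq_{n-2}}-\frac{\psi_\nu(\tau)}{q_{n-2}}(-1)^{n-1}\biggr). $$ Then every such $\zeta$ has two triple points, specified as follows. The triple points of $\zeta=(p/q,1/q)$ are $\chi^{(1)}_{-1}$ and $\chi^{(2)}_{-1}$ if $n$ is odd (type I), and $\chi^{(2)}_{+1}$ and $\chi^{(2)}_{-1}$ if $n$ is even (type II). The triple points of $\zeta=(p/q,(q-1)/q)$ are $\chi^{(1)}_{+1}$ and $\chi^{(2)}_{+1}$ if $n$ is odd (type I), and $\chi^{(2)}_{+1}$ and $\chi^{(2)}_{-1}$ if $n$ is even (type II). The triple points of all other $\zeta$ are $\chi^{(1)}_{\mu}$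 and $\chi^{(2)}_{\mu}$ if $\mu\neq0$ (in which case $\mu\in\{+1,-1\}$) (type I), and $\chi^{(2)}_{+1}$ and $\chi^{(2)}_{-1}$ if $\mu=0$ (type II).
   Context: Critical points. A pair $(\theta,\rho)\in[0,1]^2$ is a critical point if $i\theta=j+\rho$ for some $(i,j)\in\mathbb{Z}^2$. A rational critical point has the form $\zeta=(p/q,r/s)$ (fractions in lowest terms) with $s$ dividing $q$. Its upper and lower neighbours are $\zeta\!\uparrow=(p/q,r/s+1/q)$ and $\zeta\!\downarrow=(p/q,r/s-1/q)$; both lie in $[0,1]^2$ (and are rational critical points) if and only if $r/s\neq0,1$. Chains (lines). For $(i,j)\in\mathbb{Z}^2$ with $0\leqslant j\leqslant i-1$ if $i>0$, $-1\leqslant j\leqslant 0$ if $i=0$, $i\leqslant j\leqslant -1$ if $i<0$, the chain with affine parameters $(i,j)$ is the segment $\{(\theta,\rho)\in[0,1]^2: \rho=i\theta-j\}$. Dominant lines. A rational critical point $\zeta=(p/q,\rho)$ has two dominant lines (chains). If $\rho\neq0,1$: the positive one is the chain through $\zeta$ with $i>0$ minimal, the negative one is the chain through $\zeta$ with $i<0$ and $-i$ minimal. If $\rho=0$: the positive one has parameters $(i,j)=(0,0)$ and the negative one $(-q,-p)$. If $\rho=1$: the positive one has parameters $(q,p-1)$ and the negative one $(0,-1)$. Triple points. For a rational critical point $\zeta$ with two neighbours, a triple point of $\zeta$ is a common point of three concurrent dominant lines comprising one dominant line of each of $\zeta$, $\zeta\!\uparrow$, $\zeta\!\downarrow$. Continued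 fractions. Write $p/q=[a_0;a_1,\ldots,a_n]$ with $a_n=1$ (of the two representations of $p/q$, the one whose last coefficient is $1$), and $p_k/q_k=[a_0;a_1,\ldots,a_k]$ in lowest terms, $0\leqslant k\leqslant n$. *)

theory Defs
  imports Complex_Main
begin

section \<open>Rational numbers in lowest terms\<close>

text \<open>Only meaningful for rational \<open>x\<close>; the denominator is positive.\<close>

definition frac_num :: "real \<Rightarrow> int" where
  "frac_num x = fst (quotient_of (the_inv of_rat x))"

definition frac_den :: "real \<Rightarrow> int" where
  "frac_den x = snd (quotient_of (the_inv of_rat x))"

lemma
  assumes "0 < q" and "coprime p q"
  shows frac_num_divide: "frac_num (of_int p / of_int q) = p"
    and frac_den_divide: "frac_den (of_int p / of_int q) = q"
proof -
  have "of_int p / of_int q = (of_rat (Fract p q) :: real)"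
    using assms by (simp add: of_rat_rat)
  moreover have "inj (of_rat :: rat \<Rightarrow> real)"
    by (simp add: inj_def)
  ultimately have "the_inv of_rat (of_int p / of_int q :: real) = Fract p q"
    by (simp add: the_inv_f_f)
  moreover have "quotient_of (Fract p q) = (p, q)"
    using assms by (simp add: quotient_of_Fract normalize_stable)
  ultimately show "frac_num (of_int p / of_int q) = p" "frac_den (of_int p / of_int q) = q"
    by (simp_all add: frac_num_def frac_den_def)
qed


section \<open>Critical points, chains and triple points\<close>

type_synonym point = "real \<times> real"

definition unit_square :: "point set" where
  "unit_square = {0..1} \<times> {0..1}"

definition critical_point :: "point \<Rightarrow> bool" where
  "critical_point \<zeta> \<longleftrightarrow>
     \<zeta> \<in> unit_square \<and> (\<exists>i j :: int. of_int i * fst \<zeta> = of_int j + snd \<zeta>)"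

definition rational_critical_point :: "point \<Rightarrow> bool" where
  "rational_critical_point \<zeta> \<longleftrightarrow> critical_point \<zeta> \<and> fst \<zeta> \<in> \<rat> \<and> snd \<zeta> \<in> \<rat>"

definition upper_neighbour :: "point \<Rightarrow> point" where
  "upper_neighbour \<zeta> = (fst \<zeta>, snd \<zeta> + 1 / of_int (frac_den (fst \<zeta>)))"

definition lower_neighbour :: "point \<Rightarrow> point" where
  "lower_neighbour \<zeta> = (fst \<zeta>, snd \<zeta> - 1 / of_int (frac_den (fst \<zeta>)))"

definition has_two_neighbours :: "point \<Rightarrow> bool" where
  "has_two_neighbours \<zeta> \<longleftrightarrow>
     upper_neighbour \<zeta> \<in> unit_square \<and> lower_neighbour \<zeta> \<in> unit_square"

definition chain_params :: "(int \<times> int) set" where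
  "chain_params =
     {(i, j). (0 < i \<and> 0 \<le> j \<and> j \<le> i - 1) \<or> (i = 0 \<and> - 1 \<le> j \<and> j \<le> 0) \<or>
              (i < 0 \<and> i \<le> j \<and> j \<le> - 1)}"

definition chain :: "int \<times> int \<Rightarrow> point set" where
  "chain c = {(\<theta>, \<rho>) \<in> unit_square. \<rho> = of_int (fst c) * \<theta> - of_int (snd c)}"

definition chains_through :: "point \<Rightarrow> (int \<times> int) set" where
  "chains_through \<zeta> = {c \<in> chain_params. \<zeta> \<in> chain c}"

text \<open>
  Dominant lines are represented by their affine parameters. For a point off the bottom and
  top sides of the square, \<open>j\<close> is determined by \<open>i\<close>, so minimising \<open>\<bar>i\<bar>\<close> singles out one chain.
\<close>

definition positive_dominant :: "point \<Rightarrow> int \<times> int \<Rightarrow> bool" where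
  "positive_dominant \<zeta> c \<longleftrightarrow>
     (if snd \<zeta> = 0 then c = (0, 0)
      else if snd \<zeta> = 1 then c = (frac_den (fst \<zeta>), frac_num (fst \<zeta>) - 1)
      else is_arg_min fst (\<lambda>d. d \<in> chains_through \<zeta> \<and> 0 < fst d) c)"

definition negative_dominant :: "point \<Rightarrow> int \<times> int \<Rightarrow> bool" where
  "negative_dominant \<zeta> c \<longleftrightarrow>
     (if snd \<zeta> = 0 then c = (- frac_den (fst \<zeta>), - frac_num (fst \<zeta>))
      else if snd \<zeta> = 1 then c = (0, - 1)
      else is_arg_min (\<lambda>d. - fst d) (\<lambda>d. d \<in> chains_through \<zeta> \<and> fst d < 0) c)"

definition dominant_lines :: "point \<Rightarrow> point set set" where
  "dominant_lines \<zeta> = chain ` {c. positive_dominant \<zeta> c \<or> negative_dominant \<zeta> c}"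

text \<open>
  The three lines below are automatically distinct: they are graphs over \<open>\<theta>\<close> which pass through
  three different points with the same \<open>\<theta>\<close>.
\<close>

definition triple_points :: "point \<Rightarrow> point set" where
  "triple_points \<zeta> =
     {x. \<exists>A \<in> dominant_lines \<zeta>. \<exists>B \<in> dominant_lines (upper_neighbour \<zeta>).
         \<exists>C \<in> dominant_lines (lower_neighbour \<zeta>). x \<in> A \<inter> B \<inter> C}"

lemma rational_critical_point_iff:
  assumes "0 < q" "coprime p q" "0 < s" "coprime r s"
  shows "rational_critical_point (of_int p / of_int q, of_int r / of_int s) \<longleftrightarrow>
    0 \<le> p \<and> p \<le> q \<and> 0 \<le> r \<and> r \<le> s \<and> s dvd q"
proof -
  have "(\<exists>i j :: int. of_int i * (of_int p / of_int q) = of_int j + (of_int r / of_int s :: real))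
    \<longleftrightarrow> s dvd q" (is "?L \<longleftrightarrow> _")
  proof
    assume ?L
    then obtain i j :: int
      where "of_int i * (of_int p / of_int q) = of_int j + (of_int r / of_int s :: real)" by blast
    then have "real_of_int (i * p * s) = of_int (q * (j * s + r))"
      using assms by (simp add: field_simps)
    then have "i * p * s = q * (j * s + r)" by linarith
    then have "s dvd q * r"
      by (metis dvd_add_right_iff dvd_mult dvd_triv_right distrib_left)
    then show "s dvd q"
      using assms by (simp add: coprime_commute coprime_dvd_mult_left_iff)
  next
    assume "s dvd q"
    then obtain k where k: "q = s * k" by blast
    with assms have "0 < k" by (simp add: zero_less_mult_iff)
    obtain u v where uv: "u * p + v * q = 1"
      using bezout_int[of p q] assms(2) by auto
    have "r * k * u * p = - (r * k * v) * q + r * k"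
      using uv by algebra
    then have eq: "real_of_int (r * k * u) * of_int p = of_int (- (r * k * v)) * of_int q + of_int (r * k)"
      by (metis of_int_add of_int_mult)
    have rs: "of_int r / of_int s = (of_int (r * k) / of_int q :: real)"
      using k \<open>0 < k\<close> by simp
    have "of_int (r * k * u) * (of_int p / of_int q) =
        of_int (- (r * k * v)) + (of_int r / of_int s :: real)"
      unfolding rs times_divide_eq_right eq using assms by (simp add: add_divide_distrib diff_divide_distrib)
    then show ?L by blast
  qed
  then show ?thesis
    using assms
    by (auto simp: rational_critical_point_def critical_point_def unit_square_def field_simps)
qed

lemma has_two_neighbours_iff:
  assumes "0 < q" "coprime p q" "0 < s" "coprime r s"
    and "rational_critical_point (of_int p / of_int q, of_int r / of_int s)"
  shows "has_two_neighbours (of_int p / of_int q, of_int r / of_int s) \<longleftrightarrow>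
    of_int r / of_int s \<noteq> (0 :: real) \<and> of_int r / of_int s \<noteq> (1 :: real)"
proof -
  from assms have *: "0 \<le> p" "p \<le> q" "0 \<le> r" "r \<le> s" "s dvd q"
    using rational_critical_point_iff by auto
  then obtain k where k: "q = s * k" by blast
  with assms have "0 < k" by (simp add: zero_less_mult_iff)
  have "of_int r / of_int s = (of_int (r * k) / of_int q :: real)"
    using k \<open>0 < k\<close> by simp
  moreover have "0 \<le> r * k" "r * k \<le> q"
    using * \<open>0 < k\<close> k by simp_all
  moreover have "real_of_int (r * k) \<le> of_int q" "0 \<le> real_of_int (r * k)"
    using calculation by linarith+
  moreover have "real_of_int (r * k) + 1 \<le> of_int q \<longleftrightarrow> r * k \<noteq> q"
    "1 \<le> real_of_int (r * k) \<longleftrightarrow> r * k \<noteq> 0"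
    using calculation by linarith+
  moreover have "of_int (r * k) / of_int q = (1 :: real) \<longleftrightarrow> r * k = q"
    "of_int (r * k) / of_int q = (0 :: real) \<longleftrightarrow> r * k = 0"
    using assms by (simp_all only: divide_eq_1_iff divide_eq_0_iff of_int_eq_iff of_int_eq_0_iff) auto
  ultimately show ?thesis
    using assms(1) *
    by (auto simp: has_two_neighbours_def upper_neighbour_def lower_neighbour_def unit_square_def
        frac_den_divide[OF assms(1,2)] add_divide_distrib[symmetric] diff_divide_distrib[symmetric]
        simp del: of_int_mult)
qed


section \<open>Continued fractions\<close>

text \<open>\<open>cfrac n a\<close> is the value of \<open>[a 0; a 1, \<dots>, a n]\<close>.\<close>

primrec cfrac :: "nat \<Rightarrow> (nat \<Rightarrow> int) \<Rightarrow> real" where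
  "cfrac 0 a = of_int (a 0)"
| "cfrac (Suc n) a = of_int (a 0) + 1 / cfrac n (\<lambda>k. a (Suc k))"

definition expansion_ending_in_1 :: "real \<Rightarrow> (nat \<Rightarrow> int) \<Rightarrow> nat \<Rightarrow> bool" where
  "expansion_ending_in_1 x a n \<longleftrightarrow>
     (\<forall>k \<in> {1..n}. 1 \<le> a k) \<and> a n = 1 \<and> x = cfrac n a"

definition conv_num :: "(nat \<Rightarrow> int) \<Rightarrow> nat \<Rightarrow> int" where
  "conv_num a k = frac_num (cfrac k a)"

definition conv_den :: "(nat \<Rightarrow> int) \<Rightarrow> nat \<Rightarrow> int" where
  "conv_den a k = frac_den (cfrac k a)"

lemma cfrac_ge_1: "\<forall>k \<le> n. 1 \<le> a k \<Longrightarrow> 1 \<le> cfrac n a"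
proof (induction n arbitrary: a)
  case (Suc n)
  then have "1 \<le> cfrac n (\<lambda>k. a (Suc k))" "1 \<le> a 0" by simp_all
  then have "0 \<le> cfrac n (\<lambda>k. a (Suc k))" "1 \<le> a 0" by simp_all
  then have "0 \<le> 1 / cfrac n (\<lambda>k. a (Suc k))" "1 \<le> real_of_int (a 0)"
    by (simp_all only: zero_le_divide_1_iff of_int_1_le_iff)
  then show ?case unfolding cfrac.simps by linarith
qed simp

lemma expansion_ending_in_1_exists:
  "0 < q \<Longrightarrow> \<exists>a n. expansion_ending_in_1 (of_int p / of_int q) a n"
proof (induction "nat q" arbitrary: p q rule: less_induct)
  case less
  define t where "t = p mod q"
  have p: "p = q * (p div q) + t" by (simp add: t_def)
  then have p': "real_of_int p = of_int q * of_int (p div q) + of_int t"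
    by (metis of_int_add of_int_mult)
  have t: "0 \<le> t" "t < q" using less.prems by (simp_all add: t_def)
  show ?case
  proof (cases "t = 0")
    case True
    have "expansion_ending_in_1 (of_int p / of_int q) (\<lambda>k. if k = 0 then p div q - 1 else 1) 1"
      using True p' less.prems by (simp add: expansion_ending_in_1_def field_simps)
    then show ?thesis by blast
  next
    case False
    with t obtain b m where b: "expansion_ending_in_1 (of_int q / of_int t) b m"
      using less.hyps[of t q] by auto
    have gt: "1 < real_of_int q / of_int t" using t False by simp
    have b0: "1 \<le> b 0"
    proof (cases m)
      case 0
      with b show ?thesis by (simp add: expansion_ending_in_1_def)
    next
      case (Suc l)
      with b have "1 \<le> cfrac l (\<lambda>k. b (Suc k))"
        by (intro cfrac_ge_1) (auto simp: expansion_ending_in_1_def)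
      then have "1 / cfrac l (\<lambda>k. b (Suc k)) \<le> 1" by simp
      with gt b Suc show ?thesis by (simp add: expansion_ending_in_1_def)
    qed
    have "expansion_ending_in_1 (of_int p / of_int q)
        (\<lambda>k. case k of 0 \<Rightarrow> p div q | Suc l \<Rightarrow> b l) (Suc m)"
      unfolding expansion_ending_in_1_def
    proof (intro conjI ballI)
      fix k assume "k \<in> {1..Suc m}"
      then obtain l where "k = Suc l" "l \<le> m" by (cases k) auto
      with b b0 show "1 \<le> (case k of 0 \<Rightarrow> p div q | Suc l \<Rightarrow> b l)"
        by (cases l) (auto simp: expansion_ending_in_1_def)
    next
      have "cfrac m b = of_int q / of_int t"
        using b by (simp add: expansion_ending_in_1_def)
      then show "of_int p / of_int q = cfrac (Suc m) (\<lambda>k. case k of 0 \<Rightarrow> p div q | Suc l \<Rightarrow> b l)"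
        using p' less.prems by (simp add: field_simps)
    qed (use b in \<open>simp add: expansion_ending_in_1_def\<close>)
    then show ?thesis by blast
  qed
qed


section \<open>The candidate triple points\<close>

text \<open>
  Here \<open>a\<close> and \<open>n\<close> are the coefficients and the length of the expansion of \<open>fst \<zeta>\<close> ending in \<open>1\<close>.
\<close>

definition q_prime :: "(nat \<Rightarrow> int) \<Rightarrow> nat \<Rightarrow> int" where
  "q_prime a n = (- 1) ^ (n - 1) * conv_den a (n - 1)"

definition tau :: "(nat \<Rightarrow> int) \<Rightarrow> nat \<Rightarrow> point \<Rightarrow> real" where
  "tau a n \<zeta> = of_int (q_prime a n) * snd \<zeta>"

text \<open>\<open>\<tau>\<^sup>+\<close> and \<open>\<tau>\<^sup>-\<close> are the values of \<open>\<tau>\<close> at the two neighbours.\<close>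

definition mu :: "(nat \<Rightarrow> int) \<Rightarrow> nat \<Rightarrow> point \<Rightarrow> int" where
  "mu a n \<zeta> =
     2 * \<lfloor>tau a n \<zeta>\<rfloor> - \<lfloor>tau a n (lower_neighbour \<zeta>)\<rfloor> - \<lfloor>tau a n (upper_neighbour \<zeta>)\<rfloor>"

text \<open>The index \<open>\<nu>\<close> of \<open>psi\<close>, \<open>chi1\<close> and \<open>chi2\<close> is only meant to be \<open>1\<close> or \<open>- 1\<close>.\<close>

definition psi :: "int \<Rightarrow> real \<Rightarrow> int" where
  "psi \<nu> x = (if \<nu> = 1 then \<lfloor>x\<rfloor> else \<lceil>x\<rceil>)"

definition chi1 :: "(nat \<Rightarrow> int) \<Rightarrow> nat \<Rightarrow> point \<Rightarrow> int \<Rightarrow> point" where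
  "chi1 a n \<zeta> \<nu> =
     (of_int (conv_num a (n - 1)) / of_int (conv_den a (n - 1)),
      of_int (psi \<nu> (tau a n \<zeta>)) / of_int (conv_den a (n - 1)) * (- 1) ^ (n - 1))"

definition chi2 :: "(nat \<Rightarrow> int) \<Rightarrow> nat \<Rightarrow> point \<Rightarrow> int \<Rightarrow> point" where
  "chi2 a n \<zeta> \<nu> =
     (of_int (conv_num a (n - 2)) / of_int (conv_den a (n - 2)),
      snd \<zeta> * of_int (conv_den a n) / of_int (conv_den a (n - 2))
        - of_int (psi \<nu> (tau a n \<zeta>)) / of_int (conv_den a (n - 2)) * (- 1) ^ (n - 1))"

end

theory Submission
  imports Defs
begin

text \<open>
  Let \<open>P/Q\<close> be the penultimate convergent of \<open>p/q\<close> and \<open>e = pQ - qP = (-1)\<^sup>n\<^sup>-\<^sup>1\<close>. The lines with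
  integral parameters through \<open>(p/q, m/q)\<close> are \<open>\<rho> = e (m (Q\<theta> - P) - k (q\<theta> - p))\<close> with integral \<open>k\<close>,
  and the two dominant ones correspond to the two integers \<open>k\<close> adjacent to \<open>mQ/q\<close>. Three such lines
  at heights \<open>m - 1, m, m + 1\<close> are concurrent precisely if their indices are in arithmetic
  progression; the common difference \<open>0\<close> gives a point above \<open>P/Q\<close>, the difference \<open>1\<close> a point above
  the previous convergent \<open>(p - P)/(q - Q)\<close>. Since the last coefficient is \<open>1\<close>, \<open>q \<le> 2Q\<close>, hence of the
  two consecutive increments of \<open>\<lfloor>mQ/q\<rfloor>\<close>, each \<open>0\<close> or \<open>1\<close>, at least one is \<open>1\<close>. Two increments \<open>1\<close>
  are type II, unequal increments are type I, and \<open>\<mu>\<close> is \<open>e\<close> times their difference.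
\<close>

section \<open>Convergents\<close>

text \<open>Peels off the first coefficient as \<open>cfrac\<close> does, but over the integers:
  \<open>a 0 + k/h = (a 0 * h + k)/h\<close>.\<close>

primrec cfrac_pair :: "nat \<Rightarrow> (nat \<Rightarrow> int) \<Rightarrow> int \<times> int" where
  "cfrac_pair 0 a = (a 0, 1)"
| "cfrac_pair (Suc n) a =
     (let (h, k) = cfrac_pair n (\<lambda>i. a (Suc i)) in (a 0 * h + k, h))"

abbreviation cnum :: "(nat \<Rightarrow> int) \<Rightarrow> nat \<Rightarrow> int" where
  "cnum a n \<equiv> fst (cfrac_pair n a)"

abbreviation cden :: "(nat \<Rightarrow> int) \<Rightarrow> nat \<Rightarrow> int" where
  "cden a n \<equiv> snd (cfrac_pair n a)"

lemma cnum_Suc: "cnum a (Suc n) = a 0 * cnum (\<lambda>i. a (Suc i)) n + cden (\<lambda>i. a (Suc i)) n"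
  and cden_Suc: "cden a (Suc n) = cnum (\<lambda>i. a (Suc i)) n"
  by (simp_all add: case_prod_unfold Let_def)

text \<open>The classical recurrence at the far end. It survives prepending a coefficient because
  that acts linearly on the pair; for a last coefficient 1 it becomes plain addition.\<close>

lemma cfrac_pair_recurrence:
  "cnum a (Suc (Suc n)) = a (Suc (Suc n)) * cnum a (Suc n) + cnum a n"
  "cden a (Suc (Suc n)) = a (Suc (Suc n)) * cden a (Suc n) + cden a n"
proof (induction n arbitrary: a)
  case 0
  { case 1 then show ?case by (simp add: algebra_simps) }
  { case 2 then show ?case by (simp add: algebra_simps) }
next
  case (Suc n)
  { case 1 then show ?case
      unfolding cnum_Suc[where a = a] cden_Suc[where a = a] Suc.IH[of "\<lambda>i. a (Suc i)"] by algebra }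
  { case 2 then show ?case
      unfolding cden_Suc[where a = a] Suc.IH[of "\<lambda>i. a (Suc i)"] by (rule refl) }
qed

text \<open>Prepending a coefficient multiplies by a matrix of determinant -1, whence the
  alternating sign.\<close>

lemma cfrac_pair_det: "cnum a (Suc n) * cden a n - cden a (Suc n) * cnum a n = (- 1) ^ n"
proof (induction n arbitrary: a)
  case (Suc n)
  show ?case
    using Suc[of "\<lambda>i. a (Suc i)"] unfolding cnum_Suc[where a = a] cden_Suc[where a = a] power_Suc
    by (simp add: algebra_simps)
qed simp

lemma coprime_cfrac_pair: "coprime (cnum a n) (cden a n)"
proof (induction n arbitrary: a)
  case (Suc n)
  then show ?case
    using Suc[of "\<lambda>i. a (Suc i)"] unfolding cnum_Suc cden_Suc
    by (simp add: coprime_iff_gcd_eq_1 gcd.commute gcd_add_mult)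
qed simp

text \<open>Meant for tails of an expansion, whose leading coefficient is positive too.\<close>

lemma cfrac_pair_pos:
  assumes "\<And>i. i \<le> n \<Longrightarrow> 1 \<le> a i"
  shows "1 \<le> cden a n \<and> cden a n \<le> cnum a n"
  using assms
proof (induction n arbitrary: a)
  case (Suc n)
  have IH: "1 \<le> cden (\<lambda>i. a (Suc i)) n" "cden (\<lambda>i. a (Suc i)) n \<le> cnum (\<lambda>i. a (Suc i)) n"
    using Suc by auto
  moreover have "1 * cnum (\<lambda>i. a (Suc i)) n \<le> a 0 * cnum (\<lambda>i. a (Suc i)) n"
    using Suc.prems[of 0] IH by (intro mult_right_mono) auto
  ultimately show ?case
    unfolding cnum_Suc cden_Suc by linarith
qed simp

lemma cden_pos:
  assumes "\<And>i. 1 \<le> i \<Longrightarrow> i \<le> n \<Longrightarrow> 1 \<le> a i"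
  shows "1 \<le> cden a n"
proof (cases n)
  case (Suc m)
  then have "1 \<le> cden (\<lambda>i. a (Suc i)) m \<and> cden (\<lambda>i. a (Suc i)) m \<le> cnum (\<lambda>i. a (Suc i)) m"
    using assms by (intro cfrac_pair_pos) auto
  then show ?thesis unfolding Suc cden_Suc by linarith
qed simp

lemma cfrac_eq:
  assumes "\<And>i. 1 \<le> i \<Longrightarrow> i \<le> n \<Longrightarrow> 1 \<le> a i"
  shows "cfrac n a = of_int (cnum a n) / of_int (cden a n)"
  using assms
proof (induction n arbitrary: a)
  case (Suc n)
  let ?b = "\<lambda>i. a (Suc i)"
  have pos: "1 \<le> cden ?b n \<and> cden ?b n \<le> cnum ?b n"
    using Suc.prems by (intro cfrac_pair_pos) auto
  have "cfrac n ?b = of_int (cnum ?b n) / of_int (cden ?b n)"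
    using Suc.prems by (intro Suc.IH) auto
  then show ?case
    using pos unfolding cfrac.simps cnum_Suc cden_Suc
    by (simp add: add_divide_distrib)
qed simp

text \<open>The integer pair is coprime with positive denominator, so it is the fraction in lowest
  terms.\<close>

lemma conv_eq:
  assumes "\<And>i. 1 \<le> i \<Longrightarrow> i \<le> n \<Longrightarrow> 1 \<le> a i"
  shows "conv_num a n = cnum a n" "conv_den a n = cden a n"
proof -
  have "0 < cden a n" using cden_pos[of n a] assms by force
  then show "conv_num a n = cnum a n" "conv_den a n = cden a n"
    using cfrac_eq[of n a] assms coprime_cfrac_pair
    by (simp_all add: conv_num_def conv_den_def frac_num_divide frac_den_divide)
qed


section \<open>Dominant lines through the points above a fixed abscissa\<close>

text \<open>What the geometry uses from continued fractions. The inequalities place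
  \<open>P/Q\<close> and the preceding convergent \<open>(p - P)/(q - Q)\<close> in the unit
  interval; \<open>q_le\<close> reflects the last coefficient 1.\<close>

locale convergent_data =
  fixes p q P Q e :: int
  assumes det: "p * Q - q * P = e"
    and sign: "e = 1 \<or> e = - 1"
    and P_pos: "1 \<le> P" and P_le: "P \<le> Q"
    and P_le_p: "P \<le> p" and diff_le: "p - P \<le> q - Q"
    and Q_less: "Q < q" and q_le: "q \<le> 2 * Q"
begin

lemma bounds: "0 < p" "p < q" "0 < q" "0 < Q"
proof -
  show "0 < p" "0 < q" "0 < Q"
    using P_pos P_le P_le_p Q_less by linarith+
  have "p \<le> q" using P_le diff_le by linarith
  moreover have False if "p = q"
  proof -
    have "q * (Q - P) = e" using det that by (simp add: algebra_simps)
    then have "q dvd 1" using sign by (metis dvd_minus_iff dvd_triv_left)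
    then show False using P_pos P_le Q_less by auto
  qed
  ultimately show "p < q" by fastforce
qed

lemma coprime_pq: "coprime p q" and coprime_Qq: "coprime Q q"
proof -
  have "e dvd 1" using sign by auto
  have *: "c dvd 1" if "c dvd q" "c dvd p \<or> c dvd Q" for c
  proof -
    have "c dvd p * Q - q * P" using that by auto
    then show ?thesis using det \<open>e dvd 1\<close> dvd_trans by blast
  qed
  then show "coprime p q" "coprime Q q" by (auto intro!: coprimeI)
qed

text \<open>Equality in \<open>q_le\<close> leaves only the abscissa 1/2, where heights
  \<open>1\<close> and \<open>q - 1\<close> coincide.\<close>

lemma eq_double:
  assumes "q = 2 * Q"
  shows "q = 2" "Q = 1" "e = - 1"
proof -
  have "Q dvd 1" using coprime_Qq assms
    by (metis coprime_common_divisor dvd_refl dvd_triv_right)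
  then show "Q = 1" using bounds by simp
  then show "q = 2" using assms by simp
  then show "e = - 1" using det \<open>Q = 1\<close> bounds P_pos P_le by auto
qed

text \<open>By \<open>det\<close>, \<open>e * Q\<close> inverts \<open>p\<close> modulo
  \<open>q\<close>, so the integral lines through height \<open>m\<close> have the slopes congruent
  to \<open>e * m * Q\<close>; \<open>k\<close> enumerates them.\<close>

definition line :: "int \<Rightarrow> int \<Rightarrow> int \<times> int" where
  "line m k = (e * (m * Q - q * k), e * (m * P - p * k))"

text \<open>
  The dominant lines at height \<open>m/q\<close> are those of index \<open>base m\<close> and \<open>base m + 1\<close>; the values
  at \<open>0\<close> and \<open>q\<close> encode the special definition of dominance on the bottom and top sides.
\<close>

definition base :: "int \<Rightarrow> int" where
  "base m = (if m = 0 then (if e = 1 then 0 else - 1)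
             else if m = q then (if e = 1 then Q - 1 else Q)
             else m * Q div q)"

abbreviation height :: "int \<Rightarrow> point" where
  "height m \<equiv> (of_int p / of_int q, of_int m / of_int q)"

lemma chains_through_height:
  "c \<in> chains_through (height m) \<longleftrightarrow>
     c \<in> chain_params \<and> fst c * p - snd c * q = m \<and> 0 \<le> m \<and> m \<le> q"
proof -
  have "real_of_int m / of_int q = of_int (fst c) * (of_int p / of_int q) - of_int (snd c) \<longleftrightarrow>
    real_of_int m = of_int (fst c * p - snd c * q)"
    using bounds by (simp add: field_simps)
  then show ?thesis
    using bounds unfolding of_int_eq_iff
    by (auto simp: chains_through_def chain_def unit_square_def field_simps)
qed

text \<open>Since \<open>p\<close> is invertible modulo \<open>q\<close>, a point above
  \<open>p/q\<close> determines the slopes of its chains modulo \<open>q\<close>.\<close>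

lemma slope_cong:
  assumes "i * p - j * q = i' * p - j' * q"
  shows "q dvd i' - i"
proof -
  have "(i' - i) * p = q * (j' - j)" using assms by algebra
  then show ?thesis
    using coprime_pq by (metis coprime_commute coprime_dvd_mult_left_iff dvd_triv_left)
qed

text \<open>Replaces minimisation by the test \<open>0 < i < q\<close>: by \<open>slope_cong\<close>
  a smaller positive slope would differ from \<open>i\<close> by a multiple of
  \<open>q\<close>.\<close>

lemma positive_dominant_height:
  assumes "0 < m" "m < q" and c: "0 < i" "i < q" "i * p - j * q = m"
  shows "positive_dominant (height m) c \<longleftrightarrow> c = (i, j)"
proof -
  \<comment> \<open>The bounds on \<open>j\<close> demanded by \<open>chain_params\<close> follow
    from \<open>0 < p < q\<close> and \<open>0 < m < q\<close>.\<close>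
  have "(j + 1) * q = i * p + (q - m)" using c by (simp add: algebra_simps)
  moreover have "0 < i * p" using c bounds by simp
  ultimately have "0 < (j + 1) * q" using assms by linarith
  then have "0 \<le> j" using bounds by (simp add: zero_less_mult_iff)
  have "i * p < i * q" using c bounds by simp
  then have "j * q < i * q" using c assms by linarith
  then have "j < i" using bounds by simp
  have mem: "(i, j) \<in> chains_through (height m)"
    using assms \<open>0 \<le> j\<close> \<open>j < i\<close> by (auto simp: chains_through_height chain_params_def)
  have least: "i \<le> fst d" if "d \<in> chains_through (height m)" "0 < fst d" for d
  proof (rule ccontr)
    assume "\<not> i \<le> fst d"
    moreover have "q dvd i - fst d"
      using that c by (intro slope_cong[of _ "snd d" _ j]) (simp add: chains_through_height)
    ultimately show False using that c zdvd_imp_le[of q "i - fst d"] by linarith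
  qed
  have uniq: "d = (i, j)" if "d \<in> chains_through (height m)" "fst d = i" for d
  proof -
    have "i * p - snd d * q = m" using that by (auto simp: chains_through_height)
    with c have "snd d * q = j * q" by linarith
    then show ?thesis using that bounds by (simp add: prod_eq_iff)
  qed
  have "is_arg_min fst (\<lambda>d. d \<in> chains_through (height m) \<and> 0 < fst d) c \<longleftrightarrow> c = (i, j)"
  proof
    assume *: "is_arg_min fst (\<lambda>d. d \<in> chains_through (height m) \<and> 0 < fst d) c"
    then have c': "c \<in> chains_through (height m)" "0 < fst c" by (simp_all add: is_arg_min_def)
    moreover have "0 < fst (i, j)" using c by simp
    then have "\<not> fst (i, j) < fst c" using * mem unfolding is_arg_min_def by blast
    ultimately have "fst c = i" using least[of c] by simp
    then show "c = (i, j)" using uniq c' by simp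
  qed (use mem least c in \<open>fastforce simp: is_arg_min_def\<close>)
  then show ?thesis using assms bounds by (simp add: positive_dominant_def)
qed

lemma negative_dominant_height:
  assumes "0 < m" "m < q" and c: "- q < i" "i < 0" "i * p - j * q = m"
  shows "negative_dominant (height m) c \<longleftrightarrow> c = (i, j)"
proof -
  have "i * p < 0" using c bounds by (simp add: mult_less_0_iff)
  then have "j * q < 0" using c assms by linarith
  then have "j < 0" using bounds by (simp add: mult_less_0_iff)
  have "i * q < i * p" using c bounds by simp
  then have "i * q < (j + 1) * q" using c assms unfolding distrib_right by linarith
  then have "i < j + 1" using bounds by simp
  have mem: "(i, j) \<in> chains_through (height m)"
    using assms \<open>j < 0\<close> \<open>i < j + 1\<close> by (auto simp: chains_through_height chain_params_def)
  have greatest: "fst d \<le> i" if "d \<in> chains_through (height m)" "fst d < 0" for d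
  proof (rule ccontr)
    assume "\<not> fst d \<le> i"
    moreover have "q dvd fst d - i"
      using that c by (intro slope_cong[of _ j _ "snd d"]) (simp add: chains_through_height)
    ultimately show False using that c zdvd_imp_le[of q "fst d - i"] by linarith
  qed
  have uniq: "d = (i, j)" if "d \<in> chains_through (height m)" "fst d = i" for d
  proof -
    have "i * p - snd d * q = m" using that by (auto simp: chains_through_height)
    with c have "snd d * q = j * q" by linarith
    then show ?thesis using that bounds by (simp add: prod_eq_iff)
  qed
  have "is_arg_min (\<lambda>d. - fst d) (\<lambda>d. d \<in> chains_through (height m) \<and> fst d < 0) c \<longleftrightarrow> c = (i, j)"
  proof
    assume *: "is_arg_min (\<lambda>d. - fst d) (\<lambda>d. d \<in> chains_through (height m) \<and> fst d < 0) c"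
    then have c': "c \<in> chains_through (height m)" "fst c < 0" by (simp_all add: is_arg_min_def)
    moreover have "fst (i, j) < 0" using c by simp
    then have "\<not> - fst (i, j) < - fst c" using * mem unfolding is_arg_min_def by blast
    ultimately have "fst c = i" using greatest[of c] by simp
    then show "c = (i, j)" using uniq c' by simp
  qed (use mem greatest c in \<open>fastforce simp: is_arg_min_def\<close>)
  then show ?thesis using assms bounds by (simp add: negative_dominant_def)
qed

text \<open>\<open>Q\<close> is coprime to \<open>q\<close> and \<open>0 < m < q\<close>, so
  \<open>m * Q / q\<close> is not an integer and both bounds are strict.\<close>

lemma base_bounds:
  assumes "0 < m" "m < q"
  shows "q * base m < m * Q" "m * Q < q * (base m + 1)"
proof -
  have "\<not> q dvd m * Q"
    using coprime_Qq assms zdvd_not_zless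
    by (metis coprime_commute coprime_dvd_mult_left_iff)
  then have "m * Q mod q \<noteq> 0" by (simp add: dvd_eq_mod_eq_0)
  moreover have "0 \<le> m * Q mod q" "m * Q mod q < q" using bounds by simp_all
  moreover have "m * Q = q * base m + m * Q mod q" using assms by (simp add: base_def)
  ultimately show "q * base m < m * Q" "m * Q < q * (base m + 1)"
    unfolding distrib_left by linarith+
qed

lemma line_incidence: "fst (line m k) * p - snd (line m k) * q = m"
proof -
  have "e * e = 1" using sign by auto
  then show ?thesis using det unfolding line_def fst_conv snd_conv by algebra
qed

text \<open>Off the two sides, the slopes of indices \<open>base m\<close> and
  \<open>base m + 1\<close> differ by \<open>q\<close> and have opposite signs, hence both are
  extremal; \<open>e\<close> decides which one is positive.\<close>

lemma dominant_lines_height: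
  assumes "0 \<le> m" "m \<le> q"
  shows "dominant_lines (height m) = {chain (line m (base m)), chain (line m (base m + 1))}"
proof -
  let ?S = "{c. positive_dominant (height m) c \<or> negative_dominant (height m) c}"
  have den: "frac_den (of_int p / of_int q) = q" and num: "frac_num (of_int p / of_int q) = p"
    using bounds coprime_pq by (simp_all add: frac_den_divide frac_num_divide)
  have "?S = {line m (base m), line m (base m + 1)}"
  proof (cases "m = 0 \<or> m = q")
    case True
    then show ?thesis
    proof
      assume "m = 0"
      then show ?thesis using sign bounds
        by (auto simp: positive_dominant_def negative_dominant_def line_def base_def den num)
    next
      \<comment> \<open>Here the prescribed chains have indices \<open>Q\<close> and
        \<open>Q - e\<close>.\<close>
      assume "m = q"
      then show ?thesis using sign bounds det
        by (auto simp: positive_dominant_def negative_dominant_def line_def base_def den num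
          algebra_simps)
    qed
  next
    case False
    then have m: "0 < m" "m < q" using assms by auto
    note b = base_bounds[OF m]
    note inc = line_incidence[of m, unfolded line_def fst_conv snd_conv]
    from sign show ?thesis
    proof
      assume e: "e = 1"
      have "positive_dominant (height m) c \<longleftrightarrow> c = line m (base m)" for c
        unfolding line_def using inc b e by (intro positive_dominant_height m) (auto simp: algebra_simps)
      moreover have "negative_dominant (height m) c \<longleftrightarrow> c = line m (base m + 1)" for c
        unfolding line_def using inc b e by (intro negative_dominant_height m) (auto simp: algebra_simps)
      ultimately show ?thesis by auto
    next
      assume e: "e = - 1"
      have "negative_dominant (height m) c \<longleftrightarrow> c = line m (base m)" for c
        unfolding line_def using inc b e by (intro negative_dominant_height m) (auto simp: algebra_simps)
      moreover have "positive_dominant (height m) c \<longleftrightarrow> c = line m (base m + 1)" for c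
        unfolding line_def using inc b e by (intro positive_dominant_height m) (auto simp: algebra_simps)
      ultimately show ?thesis by auto
    qed
  qed
  then show ?thesis by (auto simp: dominant_lines_def)
qed


section \<open>Concurrent lines\<close>

text \<open>Where lines of equal index \<open>k\<close> meet, whatever their heights.\<close>

definition pt1 :: "int \<Rightarrow> point" where
  "pt1 k = (of_int P / of_int Q, of_int k / of_int Q)"

text \<open>Where lines meet whose index grows in step with the height, so that only
  \<open>m - k\<close> matters.\<close>

definition pt2 :: "int \<Rightarrow> int \<Rightarrow> point" where
  "pt2 m k = (of_int (p - P) / of_int (q - Q), of_int (m - k) / of_int (q - Q))"

lemma det_real: "real_of_int p * of_int Q - of_int q * of_int P = of_int e"
  using det by (metis of_int_diff of_int_mult)

text \<open>Separates height and index, as coefficients of the linear forms \<open>Q x - P\<close>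
  and \<open>q x - p\<close>.\<close>

lemma chain_line_iff:
  "(x, y) \<in> chain (line m k) \<longleftrightarrow> (x, y) \<in> unit_square \<and>
    y = of_int e * (of_int m * (of_int Q * x - of_int P) - of_int k * (of_int q * x - of_int p))"
  by (auto simp: chain_def line_def algebra_simps)

text \<open>Subtracting consecutive equations gives \<open>Q x - P = d (q x - p)\<close> for both
  index differences \<open>d\<close>. By \<open>det\<close> the two forms have no common zero, so
  \<open>q x - p\<close> cancels.\<close>

lemma concurrent_progression:
  assumes "z \<in> chain (line (m - 1) k1)" "z \<in> chain (line m k)" "z \<in> chain (line (m + 1) k2)"
  shows "k - k1 = k2 - k"
    and "of_int Q * fst z - of_int P = of_int (k - k1) * (of_int q * fst z - of_int p)"
proof -
  obtain x y where z: "z = (x, y)" by (cases z)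
  let ?u = "of_int Q * x - of_int P" and ?v = "of_int q * x - of_int p"
  have e: "real_of_int e * of_int e = 1" using sign by auto
  have y: "of_int e * y = of_int i * ?u - of_int l * ?v" if "z \<in> chain (line i l)" for i l
  proof -
    have "y = of_int e * (of_int i * ?u - of_int l * ?v)"
      using that by (simp add: z chain_line_iff)
    then show ?thesis using e by algebra
  qed
  note eqs = y[OF assms(1)] y[OF assms(2)] y[OF assms(3)]
  have u1: "?u = of_int (k - k1) * ?v" using eqs(1,2) by (simp add: algebra_simps)
  have u2: "?u = of_int (k2 - k) * ?v" using eqs(2,3) by (simp add: algebra_simps)
  have "?v \<noteq> 0"
  proof
    assume v: "?v = 0"
    with u1 have "?u = 0" by simp
    with v have "real_of_int p = of_int q * x" "real_of_int P = of_int Q * x" by simp_all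
    then have "real_of_int e = 0" using det_real by simp
    then show False using sign by auto
  qed
  with u1 u2 have "real_of_int (k - k1) = of_int (k2 - k)" by (metis mult_right_cancel)
  then show "k - k1 = k2 - k" by linarith
  show "of_int Q * fst z - of_int P = of_int (k - k1) * (of_int q * fst z - of_int p)"
    using u1 by (simp add: z)
qed

text \<open>Difference 0 forces \<open>Q x = P\<close>, where the height drops out of the equation
  of a line.\<close>

lemma concurrent_0:
  assumes "pt1 k \<in> unit_square"
  shows "chain (line (m - 1) k) \<inter> chain (line m k) \<inter> chain (line (m + 1) k) = {pt1 k}"
proof -
  have Q: "real_of_int Q > 0" using bounds by simp
  have e: "real_of_int e * of_int e = 1" using sign by auto
  have v: "of_int q * (of_int P / of_int Q) - of_int p = - of_int e / (of_int Q :: real)"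
    using det_real Q by (simp add: field_simps)
  have mem: "pt1 k \<in> chain (line i k)" for i
    using assms Q e unfolding pt1_def chain_line_iff v by (simp add: field_simps)
  have "z = pt1 k" if z: "z \<in> chain (line (m - 1) k)" "z \<in> chain (line m k)"
    "z \<in> chain (line (m + 1) k)" for z
  proof -
    have "fst z = of_int P / of_int Q"
      using concurrent_progression(2)[OF z] Q by (simp add: field_simps)
    then show ?thesis
      using z(2) mem[of m] by (cases z) (simp add: pt1_def chain_line_iff)
  qed
  then show ?thesis using mem by blast
qed

text \<open>Difference 1 forces the two linear forms to agree, which happens at
  \<open>x = (p - P)/(q - Q)\<close>.\<close>

lemma concurrent_1:
  assumes "pt2 m k \<in> unit_square"
  shows "chain (line (m - 1) (k - 1)) \<inter> chain (line m k) \<inter> chain (line (m + 1) (k + 1)) = {pt2 m k}"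
proof -
  have Q: "real_of_int (q - Q) > 0" using Q_less by simp
  have e: "real_of_int e * of_int e = 1" using sign by auto
  have v: "of_int q * (of_int (p - P) / of_int (q - Q)) - of_int p = of_int e / (of_int (q - Q) :: real)"
    using det_real Q by (simp add: field_simps)
  have u: "of_int Q * (of_int (p - P) / of_int (q - Q)) - of_int P = of_int e / (of_int (q - Q) :: real)"
    using det_real Q by (simp add: field_simps)
  \<comment> \<open>Applied with \<open>x\<close> as \<open>e\<close> and \<open>y\<close> as
    \<open>q - Q\<close>, both forms having the value \<open>x / y\<close>; the shift
    \<open>i\<close> cancels.\<close>
  have "x * (of_int (m + i) * (x / y) - of_int (k + i) * (x / y)) = (x * x) * (of_int (m - k) / y)"
    for x y :: real and i by (simp add: algebra_simps diff_divide_distrib add_divide_distrib)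
  then have mem: "pt2 m k \<in> chain (line (m + i) (k + i))" for i
    using assms e unfolding pt2_def chain_line_iff u v by simp
  have "z = pt2 m k" if z: "z \<in> chain (line (m - 1) (k - 1))" "z \<in> chain (line m k)"
    "z \<in> chain (line (m + 1) (k + 1))" for z
  proof -
    have "fst z = of_int (p - P) / of_int (q - Q)"
      using concurrent_progression(2)[OF z] Q by (simp add: field_simps)
    then show ?thesis
      using z(2) mem[of 0] by (cases z) (simp add: pt2_def chain_line_iff)
  qed
  moreover have "pt2 m k \<in> chain (line (m - 1) (k - 1))" "pt2 m k \<in> chain (line m k)"
    "pt2 m k \<in> chain (line (m + 1) (k + 1))"
    using mem[of "- 1"] mem[of 0] mem[of 1] by simp_all
  ultimately show ?thesis by blast
qed

text \<open>Chains are cut off at the square, so the candidates must be shown to lie in it. Strict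
  inequalities between multiples of \<open>q\<close> give \<open>0 <= k <= Q\<close> and
  \<open>0 <= m - k <= q - Q\<close>.\<close>

lemma in_unit_square:
  assumes "0 < m" "m < q" and k: "k = base m \<or> k = base m + 1"
  shows "pt1 k \<in> unit_square" "pt2 m k \<in> unit_square"
proof -
  note b = base_bounds[OF assms(1,2)]
  have "m * Q < q * Q" "0 < m * Q" using assms bounds by simp_all
  with b have "q * base m < q * Q" "0 < q * (base m + 1)" by linarith+
  then have "base m < Q" "0 < base m + 1" using bounds by (simp_all add: zero_less_mult_iff)
  then have k1: "0 \<le> k" "k \<le> Q" using k by auto
  \<comment> \<open>The same bounds for the complementary multiplier \<open>q - Q\<close> control
    \<open>m - k\<close>.\<close>
  have "q * (m - base m - 1) < m * (q - Q)" "m * (q - Q) < q * (m - base m)"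
    using b by (simp_all add: algebra_simps)
  moreover have "m * (q - Q) < q * (q - Q)" "0 < m * (q - Q)" using assms Q_less by simp_all
  ultimately have "q * (m - base m - 1) < q * (q - Q)" "0 < q * (m - base m)" by linarith+
  then have "m - base m - 1 < q - Q" "0 < m - base m"
    using bounds by (simp_all add: zero_less_mult_iff)
  then have k2: "0 \<le> m - k" "m - k \<le> q - Q" using k by auto
  show "pt1 k \<in> unit_square"
    using k1 P_pos P_le bounds by (simp add: pt1_def unit_square_def)
  show "pt2 m k \<in> unit_square"
    using k2 P_le_p diff_le Q_less
    by (simp add: pt2_def unit_square_def flip: of_int_diff)
qed

text \<open>Of the eight choices of indices only arithmetic progressions survive, exactly two for
  each pattern of increments listed.\<close>

lemma triple_points_height:
  assumes m: "0 < m" "m < q"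
  defines "T \<equiv> triple_points (height m)"
  shows "base m - base (m - 1) = 1 \<Longrightarrow> base (m + 1) - base m = 1 \<Longrightarrow>
      T = {pt2 m (base m), pt2 m (base m + 1)}"
    and "base m - base (m - 1) = 1 \<Longrightarrow> base (m + 1) - base m = 0 \<Longrightarrow>
      T = {pt1 (base m), pt2 m (base m)}"
    and "base m - base (m - 1) = 0 \<Longrightarrow> base (m + 1) - base m = 1 \<Longrightarrow>
      T = {pt1 (base m + 1), pt2 m (base m + 1)}"
proof -
  have den: "frac_den (of_int p / of_int q) = q"
    using bounds coprime_pq by (simp add: frac_den_divide)
  have up: "upper_neighbour (height m) = height (m + 1)"
    and low: "lower_neighbour (height m) = height (m - 1)"
    by (simp_all add: upper_neighbour_def lower_neighbour_def den add_divide_distrib diff_divide_distrib)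
  define M where "M k1 k k2 =
    chain (line (m - 1) k1) \<inter> chain (line m k) \<inter> chain (line (m + 1) k2)" for k1 k k2
  have doms: "dominant_lines (height m) = {chain (line m (base m)), chain (line m (base m + 1))}"
    "dominant_lines (height (m + 1)) =
      {chain (line (m + 1) (base (m + 1))), chain (line (m + 1) (base (m + 1) + 1))}"
    "dominant_lines (height (m - 1)) =
      {chain (line (m - 1) (base (m - 1))), chain (line (m - 1) (base (m - 1) + 1))}"
    using m by (auto intro!: dominant_lines_height simp del: of_int_add of_int_diff)
  have T: "T = (\<Union>k \<in> {base m, base m + 1}. \<Union>k2 \<in> {base (m + 1), base (m + 1) + 1}.
      \<Union>k1 \<in> {base (m - 1), base (m - 1) + 1}. M k1 k k2)"
    unfolding T_def triple_points_def up low doms M_def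
    by (rule set_eqI) (simp add: conj_disj_distribL conj_disj_distribR conj_ac disj_ac)
  have M0: "M k1 k k2 = {}" if "k - k1 \<noteq> k2 - k" for k1 k k2
    unfolding M_def by (rule equals0I) (use concurrent_progression(1) that in auto)
  note sq = in_unit_square[OF m]
  have M1: "M (base m) (base m) (base m) = {pt1 (base m)}"
    "M (base m + 1) (base m + 1) (base m + 1) = {pt1 (base m + 1)}"
    unfolding M_def by (auto intro!: concurrent_0 sq(1))
  have M2: "M (base m - 1) (base m) (base m + 1) = {pt2 m (base m)}"
    "M (base m) (base m + 1) (2 + base m) = {pt2 m (base m + 1)}"
    using concurrent_1[OF sq(2), of "base m"] concurrent_1[OF sq(2), of "base m + 1"]
    unfolding M_def by (simp_all add: add.commute)
  have lo: "base (m - 1) = base m - d" if "base m - base (m - 1) = d" for d using that by simp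
  have hi: "base (m + 1) = base m + d" if "base (m + 1) - base m = d" for d using that by simp
  { assume d: "base m - base (m - 1) = 1" "base (m + 1) - base m = 1"
    show "T = {pt2 m (base m), pt2 m (base m + 1)}"
      unfolding T lo[OF d(1)] hi[OF d(2)] by (simp add: M0 M1 M2 insert_commute) }
  { assume d: "base m - base (m - 1) = 1" "base (m + 1) - base m = 0"
    show "T = {pt1 (base m), pt2 m (base m)}"
      unfolding T lo[OF d(1)] hi[OF d(2)] by (simp add: M0 M1 M2 insert_commute) }
  { assume d: "base m - base (m - 1) = 0" "base (m + 1) - base m = 1"
    show "T = {pt1 (base m + 1), pt2 m (base m + 1)}"
      unfolding T lo[OF d(1)] hi[OF d(2)] by (simp add: M0 M1 M2 insert_commute) }
qed

text \<open>The abscissas are the two preceding convergents, which \<open>det\<close> keeps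
  apart.\<close>

lemma pt1_neq_pt2: "pt1 k \<noteq> pt2 m l"
proof
  assume "pt1 k = pt2 m l"
  then have "of_int P * (of_int q - of_int Q) = (of_int p - of_int P) * (of_int Q :: real)"
    using bounds Q_less by (simp add: pt1_def pt2_def field_simps)
  then have "real_of_int e = 0" using det_real by (simp add: algebra_simps)
  then show False using sign by auto
qed

lemma pt2_eq_iff: "pt2 m k = pt2 m l \<longleftrightarrow> k = l"
  using Q_less by (auto simp: pt2_def)


section \<open>Increments of the dominant indices\<close>

lemma base_eqI:
  assumes "0 < m" "m < q" "q * b \<le> m * Q" "m * Q < q * (b + 1)"
  shows "base m = b"
  using assms bounds int_div_pos_eq[of "m * Q" q b "m * Q - q * b"]
  by (simp add: base_def algebra_simps)

text \<open>\<open>0 < Q < q\<close> bounds a single increment; \<open>q <= 2 * Q\<close> makes two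
  consecutive ones total at least 1. The hypotheses keep all three heights off the sides, where
  \<open>base\<close> follows another rule.\<close>

lemma base_steps:
  assumes "1 < m" "m < q - 1"
  shows "base m - base (m - 1) \<in> {0, 1}" "base (m + 1) - base m \<in> {0, 1}"
    "1 \<le> base (m + 1) - base (m - 1)"
proof -
  have step: "base (l + 1) - base l \<in> {0, 1}" if "0 < l" "l + 1 < q" for l
  proof -
    have a: "q * base l < l * Q" "l * Q < q * (base l + 1)"
      using base_bounds[of l] that by auto
    have b: "q * base (l + 1) < (l + 1) * Q" "(l + 1) * Q < q * (base (l + 1) + 1)"
      using base_bounds[of "l + 1"] that by auto
    have "q * base l < q * (base (l + 1) + 1)" "q * base (l + 1) < q * (base l + 2)"
      using a b bounds Q_less by (simp_all add: algebra_simps)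
    then have "base l < base (l + 1) + 1" "base (l + 1) < base l + 2" using bounds by simp_all
    then show ?thesis by auto
  qed
  from step[of "m - 1"] step[of m] assms
  show "base m - base (m - 1) \<in> {0, 1}" "base (m + 1) - base m \<in> {0, 1}" by auto
  have "q * base (m - 1) < (m - 1) * Q" "(m + 1) * Q < q * (base (m + 1) + 1)"
    using base_bounds[of "m - 1"] base_bounds[of "m + 1"] assms by auto
  then have "q * (base (m - 1) + 1) < q * (base (m + 1) + 1)"
    using q_le by (simp add: algebra_simps)
  then have "base (m - 1) + 1 < base (m + 1) + 1" using bounds by simp
  then show "1 \<le> base (m + 1) - base (m - 1)" by simp
qed

section \<open>Values of \<open>base\<close> near the bottom and the top\<close>

lemma base_1: "base 1 = 0"
  using bounds Q_less by (intro base_eqI) auto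

text \<open>For \<open>q = 2\<close> height 2 is the top side, whose value \<open>Q\<close> for
  \<open>e = - 1\<close> still fits.\<close>

lemma base_2: "e = - 1 \<or> q \<noteq> 2 \<Longrightarrow> base 2 = 1"
proof (cases "q = 2")
  case True
  moreover assume "e = - 1 \<or> q \<noteq> 2"
  ultimately show ?thesis unfolding base_def using bounds Q_less by auto
next
  case False
  then show ?thesis using bounds Q_less q_le by (intro base_eqI) auto
qed

lemma q_neq_2: "e = 1 \<Longrightarrow> q \<noteq> 2"
  using eq_double(3) bounds Q_less by fastforce

lemma base_q_minus_1: "base (q - 1) = Q - 1"
  using bounds Q_less by (intro base_eqI) (auto simp: algebra_simps)

lemma base_q_minus_2: "e = - 1 \<or> q \<noteq> 2 \<Longrightarrow> base (q - 2) = Q - 2"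
proof (cases "q = 2")
  case True
  moreover assume "e = - 1 \<or> q \<noteq> 2"
  ultimately show ?thesis unfolding base_def using bounds Q_less by auto
next
  case False
  \<comment> \<open>Strictness gives the upper bound of the division; equality would mean
    \<open>q = 2\<close>.\<close>
  then have "q < 2 * Q" using eq_double q_le by fastforce
  then show ?thesis using bounds Q_less False by (intro base_eqI) (auto simp: algebra_simps)
qed

section \<open>Triple points next to the sides, and their number at every height\<close>

lemma triple_points_bottom:
  "triple_points (height 1) =
    (if e = 1 then {pt1 1, pt2 1 1} else {pt2 1 0, pt2 1 1})"
proof -
  \<comment> \<open>The increment from height 0 is 0 for \<open>e = 1\<close> and 1 for
    \<open>e = - 1\<close>, and the next one is 1: the rule for the bottom side makes the type
    depend on parity.\<close>
  have "base 0 = (if e = 1 then 0 else - 1)" by (simp add: base_def)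
  then show ?thesis
    using triple_points_height[of 1] base_1 base_2 q_neq_2 sign bounds by auto
qed

text \<open>Mirrors the bottom: the increment before height \<open>q - 1\<close> is 1, the one
  reaching the top is 0 or 1 according to \<open>e\<close>.\<close>

lemma triple_points_top:
  "triple_points (height (q - 1)) =
    (if e = 1 then {pt1 (Q - 1), pt2 (q - 1) (Q - 1)} else {pt2 (q - 1) (Q - 1), pt2 (q - 1) Q})"
proof -
  have "base q = (if e = 1 then Q - 1 else Q)" using bounds by (simp add: base_def)
  then show ?thesis
    using triple_points_height[of "q - 1"] base_q_minus_1 base_q_minus_2 q_neq_2 sign bounds by auto
qed

lemma card_triple_points:
  assumes "0 < m" "m < q"
  shows "card (triple_points (height m)) = 2"
proof -
  consider "m = 1" | "m = q - 1" | "1 < m" "m < q - 1" using assms by linarith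
  then show ?thesis
  proof cases
    case 1
    then show ?thesis using triple_points_bottom by (simp add: pt1_neq_pt2 pt2_eq_iff)
  next
    case 2
    then show ?thesis unfolding 2 triple_points_top by (simp add: pt1_neq_pt2 pt2_eq_iff)
  next
    case 3
    with base_steps[of m] consider
      "base m - base (m - 1) = 1" "base (m + 1) - base m = 1"
      | "base m - base (m - 1) = 1" "base (m + 1) - base m = 0"
      | "base m - base (m - 1) = 0" "base (m + 1) - base m = 1" by fastforce
    then show ?thesis
      by cases (simp_all add: triple_points_height[OF assms] pt1_neq_pt2 pt2_eq_iff)
  qed
qed

text \<open>The argument is not an integer; for \<open>e = - 1\<close> negation exchanges floor and
  ceiling, hence the shift by 1.\<close>

lemma floor_ceiling_sign:
  assumes "0 < m" "m < q"
  shows "\<lfloor>of_int (e * Q) * (of_int m / of_int q) :: real\<rfloor> =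
      (if e = 1 then base m else - base m - 1)"
    and "\<lceil>of_int (e * Q) * (of_int m / of_int q) :: real\<rceil> =
      (if e = 1 then base m + 1 else - base m)"
proof -
  have "real_of_int (q * base m) < of_int (m * Q)" "real_of_int (m * Q) < of_int (q * (base m + 1))"
    using base_bounds[OF assms] by linarith+
  then have b: "of_int (base m) < (of_int Q * (of_int m / of_int q) :: real)"
    "of_int Q * (of_int m / of_int q) < (of_int (base m) + 1 :: real)"
    using bounds by (simp_all add: field_simps)
  then show "\<lfloor>of_int (e * Q) * (of_int m / of_int q) :: real\<rfloor> =
      (if e = 1 then base m else - base m - 1)"
    using sign by (auto simp: floor_eq_iff)
  show "\<lceil>of_int (e * Q) * (of_int m / of_int q) :: real\<rceil> =
      (if e = 1 then base m + 1 else - base m)"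
    using b sign by (auto simp: ceiling_eq_iff)
qed

end


section \<open>Triple points\<close>

lemma convergent_data_expansion:
  assumes "0 < p" "p < q" "coprime p q"
    and ex: "expansion_ending_in_1 (of_int p / of_int q) a n"
  shows "2 \<le> n" "conv_den a n = q"
    and "conv_num a (n - 2) = p - conv_num a (n - 1)" "conv_den a (n - 2) = q - conv_den a (n - 1)"
    and "convergent_data p q (conv_num a (n - 1)) (conv_den a (n - 1)) ((- 1) ^ (n - 1))"
proof -
  have a: "1 \<le> a i" if "1 \<le> i" "i \<le> n" for i
    using ex that by (simp add: expansion_ending_in_1_def)
  have an: "a n = 1" and x: "of_int p / of_int q = cfrac n a"
    using ex by (simp_all add: expansion_ending_in_1_def)
  have x01: "0 < cfrac n a" "cfrac n a < 1" using assms unfolding x[symmetric] by simp_all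
  \<comment> \<open>For \<open>n\<close> at most 1 the final coefficient 1 would make the value an
    integer.\<close>
  have "n \<noteq> 0" using an x01 by (cases n) auto
  moreover have "n \<noteq> 1"
  proof
    assume "n = 1"
    then have "cfrac n a = of_int (a 0 + 1)" using an by simp
    with x01 have "0 < a 0 + 1" "a 0 + 1 < 1" by linarith+
    then show False by linarith
  qed
  ultimately show "2 \<le> n" by simp
  then obtain l where n: "n = Suc (Suc l)" by (metis add_2_eq_Suc le_Suc_ex)
  have pq: "conv_num a n = p" "conv_den a n = q"
    using assms(1-3) unfolding conv_num_def conv_den_def x[symmetric]
    by (simp_all add: frac_num_divide frac_den_divide)
  then show "conv_den a n = q" by simp
  have conv: "conv_num a i = cnum a i" "conv_den a i = cden a i" if "i \<le> n" for i
    using that a by (auto intro!: conv_eq)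
  \<comment> \<open>A tail of value at least 1 leaves the leading coefficient strictly between -1
    and 1.\<close>
  have "1 \<le> cfrac (Suc l) (\<lambda>k. a (Suc k))" using a n by (intro cfrac_ge_1) auto
  then have "0 < 1 / cfrac (Suc l) (\<lambda>k. a (Suc k))" "1 / cfrac (Suc l) (\<lambda>k. a (Suc k)) \<le> 1"
    by simp_all
  then have "- 1 < real_of_int (a 0)" "real_of_int (a 0) < 1"
    using x01 unfolding n cfrac.simps(2)[of "Suc l"] by linarith+
  then have a0: "a 0 = 0" by linarith
  have rec: "p = cnum a (Suc l) + cnum a l" "q = cden a (Suc l) + cden a l"
    using pq conv[of n] cfrac_pair_recurrence[of l a] an n by (simp_all only: mult_1 le_refl)
  then show *: "conv_num a (n - 2) = p - conv_num a (n - 1)"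
    "conv_den a (n - 2) = q - conv_den a (n - 1)"
    using n conv[of l] conv[of "Suc l"] by simp_all
  have conv_le: "0 \<le> cnum a i \<and> cnum a i \<le> cden a i \<and> (0 < i \<longrightarrow> 1 \<le> cnum a i)" if "i \<le> n" for i
  proof (cases i)
    case (Suc j)
    then have "1 \<le> cden (\<lambda>i. a (Suc i)) j \<and> cden (\<lambda>i. a (Suc i)) j \<le> cnum (\<lambda>i. a (Suc i)) j"
      using that a by (intro cfrac_pair_pos) auto
    then show ?thesis using a0 Suc by (simp only: cnum_Suc cden_Suc) simp
  qed (simp add: a0)
  have den: "1 \<le> cden a i" if "i \<le> n" for i using cden_pos[of i a] a that by auto
  \<comment> \<open>As \<open>q = cden a (Suc l) + cden a l\<close>, this is the source of
    \<open>q <= 2 * Q\<close>.\<close>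
  have mono: "cden a l \<le> cden a (Suc l)"
  proof (cases l)
    case 0
    then show ?thesis using den[of 1] n by simp
  next
    case (Suc j)
    have "1 * cden a (Suc j) \<le> a (Suc (Suc j)) * cden a (Suc j)"
      using a[of "Suc (Suc j)"] den[of "Suc j"] Suc n by (intro mult_right_mono) auto
    moreover have "1 \<le> cden a j" using den[of j] Suc n by simp
    ultimately show ?thesis unfolding Suc cfrac_pair_recurrence by linarith
  qed
  have "p * cden a (Suc l) - q * cnum a (Suc l) = (- 1) ^ Suc l"
    using cfrac_pair_det[where a = a and n = "Suc l"] pq conv[of n] n by simp
  then show "convergent_data p q (conv_num a (n - 1)) (conv_den a (n - 1)) ((- 1) ^ (n - 1))"
    using conv_le[of l] conv_le[of "Suc l"] rec mono den[of l] conv[of "Suc l"] n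
    by unfold_locales (auto simp: minus_one_power_iff)
qed

theorem theorem7:
  fixes p q r s :: int and a :: "nat \<Rightarrow> int" and n :: nat and \<zeta> :: point
  assumes "0 < q" and "coprime p q" and "0 < s" and "coprime r s"
    and "\<zeta> = (of_int p / of_int q, of_int r / of_int s)"
    and "rational_critical_point \<zeta>"
    and "has_two_neighbours \<zeta>"
    and "expansion_ending_in_1 (of_int p / of_int q) a n"
  shows "card (triple_points \<zeta>) = 2 \<and>
    (\<zeta> = (of_int p / of_int q, 1 / of_int q) \<longrightarrow>
      (odd n \<longrightarrow> triple_points \<zeta> = {chi1 a n \<zeta> (- 1), chi2 a n \<zeta> (- 1)}) \<and>
      (even n \<longrightarrow> triple_points \<zeta> = {chi2 a n \<zeta> 1, chi2 a n \<zeta> (- 1)})) \<and>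
    (\<zeta> = (of_int p / of_int q, of_int (q - 1) / of_int q) \<longrightarrow>
      (odd n \<longrightarrow> triple_points \<zeta> = {chi1 a n \<zeta> 1, chi2 a n \<zeta> 1}) \<and>
      (even n \<longrightarrow> triple_points \<zeta> = {chi2 a n \<zeta> 1, chi2 a n \<zeta> (- 1)})) \<and>
    (\<zeta> \<noteq> (of_int p / of_int q, 1 / of_int q) \<and>
     \<zeta> \<noteq> (of_int p / of_int q, of_int (q - 1) / of_int q) \<longrightarrow>
      (mu a n \<zeta> \<noteq> 0 \<longrightarrow>
        mu a n \<zeta> \<in> {1, - 1} \<and>
        triple_points \<zeta> = {chi1 a n \<zeta> (mu a n \<zeta>), chi2 a n \<zeta> (mu a n \<zeta>)}) \<and>
      (mu a n \<zeta> = 0 \<longrightarrow> triple_points \<zeta> = {chi2 a n \<zeta> 1, chi2 a n \<zeta> (- 1)}))"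
proof -
  obtain t where t: "q = s * t"
    using assms rational_critical_point_iff by (metis dvdE)
  then have "0 < t" using assms by (simp add: zero_less_mult_iff)
  \<comment> \<open>The height of the point in units of \<open>1/q\<close>.\<close>
  define m where "m = r * t"
  have rs: "of_int r / of_int s = (of_int m / of_int q :: real)"
    using t \<open>0 < t\<close> by (simp add: m_def)
  have range: "0 \<le> p" "p \<le> q" "0 \<le> r" "r \<le> s"
    using assms rational_critical_point_iff by auto
  have "of_int r / of_int s \<noteq> (0 :: real)" "of_int r / of_int s \<noteq> (1 :: real)"
    using assms has_two_neighbours_iff by blast+
  then have "0 < r" "r < s" using range assms(3) by (auto simp: order.order_iff_strict)
  then have m: "0 < m" "m < q" using t \<open>0 < t\<close> by (auto simp: m_def)
  \<comment> \<open>Otherwise coprimality gives \<open>q = 1\<close>, with no room for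
    \<open>0 < m < q\<close>.\<close>
  have "p \<noteq> 0" "p \<noteq> q" using m assms(2) by auto
  with range have p: "0 < p" "p < q" by auto
  note cd = convergent_data_expansion[OF p assms(2,8)]
  define P Q and e :: int where "P = conv_num a (n - 1)" and "Q = conv_den a (n - 1)"
    and "e = (- 1) ^ (n - 1)"
  interpret convergent_data p q P Q e using cd(5) by (simp add: P_def Q_def e_def)
  have e: "e = (if odd n then 1 else - 1)" using cd(1) by (simp add: e_def minus_one_power_iff)
  have e_real: "(- 1) ^ (n - 1) = real_of_int e" by (simp add: e_def)
  have \<zeta>: "\<zeta> = height m" using assms(5) rs by simp
  have up: "upper_neighbour \<zeta> = height (m + 1)" and low: "lower_neighbour \<zeta> = height (m - 1)"
    using assms(1,2)
    by (simp_all add: \<zeta> upper_neighbour_def lower_neighbour_def frac_den_divide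
        add_divide_distrib diff_divide_distrib)
  have tau: "tau a n (height l) = of_int (e * Q) * (of_int l / of_int q)" for l
    by (simp add: tau_def q_prime_def e_def Q_def)
  \<comment> \<open>After multiplication by \<open>e\<close>, the choice depends only on whether
    \<open>\<nu>\<close> equals \<open>e\<close>, for both parities of \<open>n\<close>.\<close>
  have psi: "e * psi \<nu> (tau a n \<zeta>) = (if \<nu> = e then base m else base m + 1)"
    if "\<nu> = 1 \<or> \<nu> = - 1" for \<nu>
    using that sign unfolding \<zeta> tau psi_def floor_ceiling_sign[OF m] by auto
  have psi_real: "of_int (psi \<nu> (tau a n \<zeta>)) * real_of_int e =
      of_int (if \<nu> = e then base m else base m + 1)" if "\<nu> = 1 \<or> \<nu> = - 1" for \<nu>
    using arg_cong[OF psi[OF that], of real_of_int] by (simp add: mult.commute)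
  have chi1: "chi1 a n \<zeta> \<nu> = pt1 (if \<nu> = e then base m else base m + 1)"
    if "\<nu> = 1 \<or> \<nu> = - 1" for \<nu>
    using psi_real[OF that]
    unfolding chi1_def pt1_def e_real P_def[symmetric] Q_def[symmetric] by simp
  have chi2: "chi2 a n \<zeta> \<nu> = pt2 m (if \<nu> = e then base m else base m + 1)"
    if "\<nu> = 1 \<or> \<nu> = - 1" for \<nu>
    using psi_real[OF that] m bounds
    unfolding chi2_def pt2_def e_real cd(2-4) P_def[symmetric] Q_def[symmetric]
    by (simp add: \<zeta> diff_divide_distrib)
  have bottom: "\<zeta> = (of_int p / of_int q, 1 / of_int q) \<longleftrightarrow> m = 1"
    and top: "\<zeta> = (of_int p / of_int q, of_int (q - 1) / of_int q) \<longleftrightarrow> m = q - 1"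
    using m unfolding \<zeta> prod.inject by (simp_all flip: of_int_diff)
  have floor_tau: "\<lfloor>tau a n (height l)\<rfloor> = (if e = 1 then base l else - base l - 1)"
    if "0 < l" "l < q" for l
    unfolding tau by (rule floor_ceiling_sign(1)[OF that])
  \<comment> \<open>In this second difference the constants \<open>- 1\<close> of the case
    \<open>e = - 1\<close> cancel.\<close>
  have mu: "mu a n \<zeta> = e * ((base m - base (m - 1)) - (base (m + 1) - base m))"
    if "1 < m" "m < q - 1"
    unfolding mu_def up low unfolding \<zeta>
    using floor_tau[of "m - 1"] floor_tau[of m] floor_tau[of "m + 1"] that sign by auto
  show ?thesis
  proof (intro conjI impI)
    show "card (triple_points \<zeta>) = 2" using card_triple_points[OF m] by (simp only: \<zeta>)
  next
    assume "\<zeta> = (of_int p / of_int q, 1 / of_int q)" "odd n"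
    then show "triple_points \<zeta> = {chi1 a n \<zeta> (- 1), chi2 a n \<zeta> (- 1)}"
      using triple_points_bottom base_1 e unfolding bottom by (simp add: chi1 chi2) (simp add: \<zeta>)
  next
    assume "\<zeta> = (of_int p / of_int q, 1 / of_int q)" "even n"
    then show "triple_points \<zeta> = {chi2 a n \<zeta> 1, chi2 a n \<zeta> (- 1)}"
      using triple_points_bottom base_1 e unfolding bottom by (simp add: chi2) (auto simp: \<zeta>)
  next
    assume "\<zeta> = (of_int p / of_int q, of_int (q - 1) / of_int q)" "odd n"
    then show "triple_points \<zeta> = {chi1 a n \<zeta> 1, chi2 a n \<zeta> 1}"
      using triple_points_top base_q_minus_1 e unfolding top by (simp add: chi1 chi2) (simp add: \<zeta>)
  next
    assume "\<zeta> = (of_int p / of_int q, of_int (q - 1) / of_int q)" "even n"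
    then show "triple_points \<zeta> = {chi2 a n \<zeta> 1, chi2 a n \<zeta> (- 1)}"
      using triple_points_top base_q_minus_1 e unfolding top by (simp add: chi2) (auto simp: \<zeta>)
  next
    assume "\<zeta> \<noteq> (of_int p / of_int q, 1 / of_int q) \<and>
      \<zeta> \<noteq> (of_int p / of_int q, of_int (q - 1) / of_int q)"
    then have int: "1 < m" "m < q - 1" using m unfolding bottom top by linarith+
    note steps = base_steps[OF int]
    note T = triple_points_height[OF m, folded \<zeta>]
    { assume "mu a n \<zeta> \<noteq> 0"
      \<comment> \<open>\<open>mu = e\<close> makes \<open>chi1\<close> and \<open>chi2\<close> use
        index \<open>base m\<close>, and \<open>mu = - e\<close> index \<open>base m + 1\<close>, as
        the two patterns require.\<close>
      with mu[OF int] steps consider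
        "base m - base (m - 1) = 1" "base (m + 1) - base m = 0" "mu a n \<zeta> = e"
        | "base m - base (m - 1) = 0" "base (m + 1) - base m = 1" "mu a n \<zeta> = - e"
        by fastforce
      then show "mu a n \<zeta> \<in> {1, - 1}"
        "triple_points \<zeta> = {chi1 a n \<zeta> (mu a n \<zeta>), chi2 a n \<zeta> (mu a n \<zeta>)}"
        using sign by (cases; auto simp: T chi1 chi2)+ }
    { assume "mu a n \<zeta> = 0"
      \<comment> \<open>Equal increments must both be 1, since \<open>steps\<close> excludes two
        zeros.\<close>
      with mu[OF int] steps sign
      have "base m - base (m - 1) = 1" "base (m + 1) - base m = 1" by auto
      then show "triple_points \<zeta> = {chi2 a n \<zeta> 1, chi2 a n \<zeta> (- 1)}"
        using sign by (auto simp: T chi2) }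
  qed
qed

end
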